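(* Let $B$ be a finite edge-clean bidirected graph rooted at $r$ and let $x\in V(B)\setminus\{r\}$. Then $$\lambda_B^{\mathrm{trail}}(r,x)=\min\left\{\left|\delta_{r,B}^{\mathsf{trail}}(X)\right| : x\in X\subseteq V(B)\setminus\{r\}\right\}.$$
   Context: A bidirected graph $B=(G,\sigma)$ is a loopless multigraph $G$ together with a map $\sigma$ assigning to each half-edge $(e,u)$ ($u$ an endpoint of the edge $e$) a sign $\sigma(e,u)\in\{+,-\}$. An oriented edge $\vec e$ is an edge $e$ with a choice of which endpoint is its tail and which its head; $\overleftarrow{e}$ is the opposite orientation. A trail is a sequence $v_0\vec e_1v_1\dots\vec e_\ell v_\ell$ in which the edges $e_i$ are pairwise distinct, $\vec e_i$ has tail $v_{i-1}$ and head $v_i$, and $\sigma(e_{i+1},v_i)=-\sigma(e_i,v_i)$ for $1\le i<\ell$; it is a $v_0$--$v_\ell$ trail. Two trails are edge-disjoint if they share no underlying edge. $B$ is rooted if it has a designated root vertex $r$. An $r$-trail is a trail starting in $r$ with no internal vertex equal to $r$. An $r$--$\vec e$ trail is an $r$-trail whose last oriented edge is $\vec e$. An edge $e$ is trail-undirectable if there are both an $r$--$\vec e$ trail and an $r$--$\overleftarrow{e}$ trail. $B$ is edge-clean if no trail-undirectable edge is incident with $r$ (equivalently, $r$ lies in no nontrivial connected component of the subgraph formed by the trail-undirectable edges). $\lambda_B^{\mathrm{trail}}(v,w)$ is the maximum number of pairwise edge-disjoint $v$--$w$ trails in $B$. For $X\subseteq V(B)\setminus\{r\}$, $\delta_{r,B}^{\mathsf{trail}}(X)$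 is the set of edges $e\in E(B)$ having an orientation $\vec e$ whose head is in $X$, whose tail is not in $X$, and for which an $r$--$\vec e$ trail exists. *)

theory Defs
  imports Main
begin

datatype edge_sign = Plus | Minus

instantiation edge_sign :: uminus
begin

definition uminus_edge_sign :: "edge_sign \<Rightarrow> edge_sign" where
  "- s = (case s of Plus \<Rightarrow> Minus | Minus \<Rightarrow> Plus)"

instance ..

end

text \<open>
  Only the values \<open>half_sign B e u\<close> with \<open>e \<in> edges B\<close> and \<open>u \<in> ends B e\<close> carry meaning; these
  arguments are the half-edges.  Distinct edges may have the same ends.
\<close>

record ('v, 'e) bigraph =
  verts :: "'v set"
  edges :: "'e set"
  ends :: "'e \<Rightarrow> 'v set"
  half_sign :: "'e \<Rightarrow> 'v \<Rightarrow> edge_sign"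

locale bidirected_graph =
  fixes B :: "('v, 'e) bigraph"
  assumes ends_verts: "e \<in> edges B \<Longrightarrow> ends B e \<subseteq> verts B"
    and loopless: "e \<in> edges B \<Longrightarrow> card (ends B e) = 2"

locale finite_bidirected_graph = bidirected_graph B for B :: "('v, 'e) bigraph" +
  assumes finite_verts: "finite (verts B)"
    and finite_edges: "finite (edges B)"

locale finite_rooted_bidirected_graph = finite_bidirected_graph B for B :: "('v, 'e) bigraph" +
  fixes r :: 'v
  assumes root_vert: "r \<in> verts B"

datatype ('v, 'e) oriented_edge = Oriented (tail: 'v) (edge: 'e) (head: 'v)

fun reverse :: "('v, 'e) oriented_edge \<Rightarrow> ('v, 'e) oriented_edge" where
  "reverse (Oriented u e v) = Oriented v e u"

definition oriented_edges :: "('v, 'e) bigraph \<Rightarrow> ('v, 'e) oriented_edge set" where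
  "oriented_edges B = {a. edge a \<in> edges B \<and> tail a \<noteq> head a \<and> ends B (edge a) = {tail a, head a}}"

text \<open>
  A trail is given by its first vertex and the list of its oriented edges, which determine the
  remaining vertices.  The empty list is the trivial trail, consisting of a single vertex.
\<close>

definition is_trail ::
    "('v, 'e) bigraph \<Rightarrow> 'v \<Rightarrow> ('v, 'e) oriented_edge list \<Rightarrow> 'v \<Rightarrow> bool" where
  "is_trail B v p w \<longleftrightarrow>
     v \<in> verts B \<and>
     set p \<subseteq> oriented_edges B \<and>
     distinct (map edge p) \<and>
     successively (\<lambda>a b. tail b = head a \<and>
       half_sign B (edge b) (head a) = - half_sign B (edge a) (head a)) p \<and>
     (if p = [] then w = v else tail (hd p) = v \<and> head (last p) = w)"

text \<open>The internal vertices of a trail are the heads of all its oriented edges but the last.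
  In particular an \<open>r\<close>-trail may end in \<open>r\<close>.\<close>

definition is_root_trail ::
    "('v, 'e) bigraph \<Rightarrow> 'v \<Rightarrow> ('v, 'e) oriented_edge list \<Rightarrow> bool" where
  "is_root_trail B r p \<longleftrightarrow> (\<exists>w. is_trail B r p w) \<and> r \<notin> head ` set (butlast p)"

definition trail_reachable :: "('v, 'e) bigraph \<Rightarrow> 'v \<Rightarrow> ('v, 'e) oriented_edge \<Rightarrow> bool" where
  "trail_reachable B r a \<longleftrightarrow> (\<exists>p. is_root_trail B r p \<and> p \<noteq> [] \<and> last p = a)"

definition trail_undirectable :: "('v, 'e) bigraph \<Rightarrow> 'v \<Rightarrow> 'e \<Rightarrow> bool" where
  "trail_undirectable B r e \<longleftrightarrow>
     (\<exists>a\<in>oriented_edges B. edge a = e \<and> trail_reachable B r a \<and> trail_reachable B r (reverse a))"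

definition edge_clean :: "('v, 'e) bigraph \<Rightarrow> 'v \<Rightarrow> bool" where
  "edge_clean B r \<longleftrightarrow> (\<forall>e\<in>edges B. trail_undirectable B r e \<longrightarrow> r \<notin> ends B e)"

definition edge_disjoint ::
    "('v, 'e) oriented_edge list \<Rightarrow> ('v, 'e) oriented_edge list \<Rightarrow> bool" where
  "edge_disjoint p q \<longleftrightarrow> edge ` set p \<inter> edge ` set q = {}"

text \<open>In a finite graph there are only finitely many trails, so the maximum below exists.\<close>

definition trail_connectivity :: "('v, 'e) bigraph \<Rightarrow> 'v \<Rightarrow> 'v \<Rightarrow> nat" where
  "trail_connectivity B v w =
     Max {card T | T. T \<subseteq> {p. is_trail B v p w} \<and> pairwise edge_disjoint T}"

definition trail_boundary :: "('v, 'e) bigraph \<Rightarrow> 'v \<Rightarrow> 'v set \<Rightarrow> 'e set" where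
  "trail_boundary B r X =
     {e \<in> edges B. \<exists>a\<in>oriented_edges B.
        edge a = e \<and> head a \<in> X \<and> tail a \<notin> X \<and> trail_reachable B r a}"

end

theory Submission
  imports Defs
begin

text \<open>
  Call an oriented edge an arc if it is reachable from \<open>r\<close> but its reverse is not.  For an arc \<open>f\<close>
  let the blossom of \<open>f\<close> be the largest edge set \<open>S\<close> such that every edge of \<open>S\<close> can be traversed in
  both directions by trails that start with \<open>f\<close> and continue in \<open>S\<close>.  By its maximality a trail that
  continues past \<open>f\<close> along undirectable edges stays in the blossom of \<open>f\<close>, so the nonempty
  blossoms are exactly the nontrivial components of the undirectable edges.  Each is entered only
  by its arc \<open>f\<close>: any other entrance would allow traversing \<open>f\<close> backwards.  Having entered by \<open>f\<close>,
  a trail can leave by any other arc, since vertices of the blossom are reached with both signs.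

  Hence edge-disjoint trails from \<open>r\<close> to \<open>x\<close> correspond to vertex-disjoint paths in the digraph
  whose vertices are the arcs and in which \<open>a\<close> is joined to \<open>b\<close> if \<open>b\<close> can follow \<open>a\<close>, possibly
  after a detour through the blossom of \<open>a\<close>; distinct arcs have disjoint blossoms.  Menger's
  theorem applies there, and a separating set of arcs contains the boundary of the set of vertices
  that cannot be reached past it.
\<close>

section \<open>Menger's theorem for digraphs\<close>

definition path_between :: "('a \<times> 'a) set \<Rightarrow> 'a set \<Rightarrow> 'a set \<Rightarrow> 'a list \<Rightarrow> bool" where
  "path_between E I J p \<longleftrightarrow>
     p \<noteq> [] \<and> hd p \<in> I \<and> last p \<in> J \<and> successively (\<lambda>a b. (a, b) \<in> E) p"

definition separates :: "('a \<times> 'a) set \<Rightarrow> 'a set \<Rightarrow> 'a set \<Rightarrow> 'a set \<Rightarrow> bool" where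
  "separates E I J Z \<longleftrightarrow> (\<forall>p. path_between E I J p \<longrightarrow> set p \<inter> Z \<noteq> {})"

definition disjoint_paths :: "('a \<times> 'a) set \<Rightarrow> 'a set \<Rightarrow> 'a set \<Rightarrow> 'a list set \<Rightarrow> bool" where
  "disjoint_paths E I J P \<longleftrightarrow>
     finite P \<and> (\<forall>p\<in>P. path_between E I J p \<and> distinct p) \<and>
     pairwise (\<lambda>p q. set p \<inter> set q = {}) P"

lemma path_between_mono:
  assumes "path_between E I J p" and "E \<subseteq> E'"
  shows "path_between E' I J p"
  using assms unfolding path_between_def by (auto elim: successively_mono)

text \<open>The arc \<open>(x, y)\<close> can only be taken when leaving an occurrence of
  \<open>x\<close> before the last position. The end \<open>z\<close> stays unrestricted because it
  may be \<open>x\<close> itself.\<close>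

lemma successively_remove_arc_source:
  assumes "successively (\<lambda>a b. (a, b) \<in> insert (x, y) E) (p @ [z])" and "x \<notin> set p"
  shows "successively (\<lambda>a b. (a, b) \<in> E) (p @ [z])"
  using assms
proof (induction p)
  case (Cons a p)
  then show ?case by (cases p) auto
qed simp

lemma successively_remove_arc_target:
  assumes "successively (\<lambda>a b. (a, b) \<in> insert (x, y) E) (z # p)" and "y \<notin> set p"
  shows "successively (\<lambda>a b. (a, b) \<in> E) (z # p)"
  using assms
proof (induction p arbitrary: z)
  case (Cons a p)
  then show ?case by auto
qed simp

text \<open>A walk that avoids \<open>x\<close> cannot take the new arc, so it is already a walk of
  \<open>E\<close> and meets \<open>S\<close>.\<close>

lemma separates_insert_source:
  assumes "separates E I J S"
  shows "separates (insert (x, y) E) I J (insert x S)"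
  unfolding separates_def
proof (intro allI impI notI)
  fix p
  assume p: "path_between (insert (x, y) E) I J p" and "set p \<inter> insert x S = {}"
  then have "x \<notin> set (butlast p)" by (auto dest: in_set_butlastD)
  moreover have "butlast p @ [last p] = p" using p by (simp add: path_between_def)
  ultimately have "path_between E I J p"
    using p successively_remove_arc_source[of x y E "butlast p" "last p"]
    by (simp add: path_between_def)
  then show False using assms \<open>set p \<inter> insert x S = {}\<close> by (auto simp: separates_def)
qed

lemma separates_insert_target:
  assumes "separates E I J S"
  shows "separates (insert (x, y) E) I J (insert y S)"
  unfolding separates_def
proof (intro allI impI notI)
  fix p
  assume p: "path_between (insert (x, y) E) I J p" and "set p \<inter> insert y S = {}"
  moreover obtain a q where "p = a # q" using p by (cases p) (auto simp: path_between_def)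
  ultimately have "path_between E I J p"
    using successively_remove_arc_target[of x y E a q] by (auto simp: path_between_def)
  then show False using assms \<open>set p \<inter> insert y S = {}\<close> by (auto simp: separates_def)
qed

text \<open>Cutting a walk at its first vertex in \<open>insert x S\<close> leaves a segment that
  has not yet left \<open>x\<close>. So it lies in \<open>E\<close> and must meet
  \<open>Z\<close>.\<close>

lemma separates_first_half:
  assumes S: "separates (insert (x, y) E) I J (insert x S)" and Z: "separates E I (insert x S) Z"
  shows "separates (insert (x, y) E) I J Z"
  unfolding separates_def
proof (intro allI impI)
  fix p
  assume p: "path_between (insert (x, y) E) I J p"
  then obtain u z w where split: "p = u @ z # w" "z \<in> insert x S" "\<forall>v\<in>set u. v \<notin> insert x S"
    using S split_list_first_prop[of p "\<lambda>v. v \<in> insert x S"] unfolding separates_def by blast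
  have "successively (\<lambda>a b. (a, b) \<in> insert (x, y) E) ((u @ [z]) @ w)"
    using p split by (simp add: path_between_def)
  then have "successively (\<lambda>a b. (a, b) \<in> insert (x, y) E) (u @ [z])"
    unfolding successively_append_iff by blast
  then have "successively (\<lambda>a b. (a, b) \<in> E) (u @ [z])"
    using split by (intro successively_remove_arc_source) auto
  then have "path_between E I (insert x S) (u @ [z])"
    using p split by (cases u) (auto simp: path_between_def)
  then have "set (u @ [z]) \<inter> Z \<noteq> {}" using Z unfolding separates_def by blast
  then show "set p \<inter> Z \<noteq> {}" using split by auto
qed

text \<open>Mirror image of the previous argument: the segment from the last vertex in
  \<open>insert y S\<close> never enters \<open>y\<close> again, so it avoids the new arc.\<close>

lemma separates_second_half:
  assumes S: "separates (insert (x, y) E) I J (insert y S)" and Z: "separates E (insert y S) J Z"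
  shows "separates (insert (x, y) E) I J Z"
  unfolding separates_def
proof (intro allI impI)
  fix p
  assume p: "path_between (insert (x, y) E) I J p"
  then obtain u z w where split: "p = u @ z # w" "z \<in> insert y S" "\<forall>v\<in>set w. v \<notin> insert y S"
    using S split_list_last_prop[of p "\<lambda>v. v \<in> insert y S"] unfolding separates_def by blast
  have "successively (\<lambda>a b. (a, b) \<in> insert (x, y) E) (z # w)"
    using p split by (simp add: path_between_def successively_append_iff)
  then have "successively (\<lambda>a b. (a, b) \<in> E) (z # w)"
    using split by (intro successively_remove_arc_target) auto
  then have "path_between E (insert y S) J (z # w)"
    using p split by (auto simp: path_between_def)
  then have "set (z # w) \<inter> Z \<noteq> {}" using Z unfolding separates_def by blast
  then show "set p \<inter> Z \<noteq> {}" using split by auto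
qed

text \<open>Disjoint paths choose distinct points of \<open>K\<close>, and by counting every point
  is chosen. A second point of \<open>K\<close> on a path would be the choice of another path,
  against disjointness.\<close>

lemma disjoint_paths_endpoint_bij:
  assumes P: "disjoint_paths E I J P" and card: "card P = card K" and fin: "finite K"
    and h: "\<forall>p\<in>P. h p \<in> set p \<and> h p \<in> K"
  shows "bij_betw h P K" and "\<And>p z. p \<in> P \<Longrightarrow> z \<in> set p \<Longrightarrow> z \<in> K \<Longrightarrow> z = h p"
proof -
  have inj: "inj_on h P"
  proof (rule inj_onI)
    fix p q assume "p \<in> P" "q \<in> P" "h p = h q"
    then have "set p \<inter> set q \<noteq> {}" using h by (metis disjoint_iff)
    then show "p = q" using P \<open>p \<in> P\<close> \<open>q \<in> P\<close> by (auto simp: disjoint_paths_def pairwise_def)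
  qed
  have "h ` P = K"
    using h fin card inj by (intro card_subset_eq) (auto simp: card_image)
  with inj show "bij_betw h P K" by (simp add: bij_betw_def)
  fix p z assume "p \<in> P" "z \<in> set p" "z \<in> K"
  then obtain q where q: "q \<in> P" "z = h q" using \<open>h ` P = K\<close> by auto
  then have "z \<in> set p \<inter> set q" using h \<open>z \<in> set p\<close> by auto
  then have "p = q" using P \<open>p \<in> P\<close> \<open>q \<in> P\<close> by (auto simp: disjoint_paths_def pairwise_def)
  then show "z = h p" using q by simp
qed

text \<open>Since \<open>S\<close> separates in \<open>E\<close>, a path of \<open>P\<close> and a
  path of \<open>Q\<close> can meet only in a common end in \<open>S\<close>. Paths are therefore
  joined at the vertices of \<open>S\<close>, and one further pair is joined across the new
  arc.\<close>

lemma join_disjoint_paths: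
  assumes S: "separates E I J S" and fin: "finite S" and xy: "x \<notin> S" "y \<notin> S"
    and P: "disjoint_paths E I (insert x S) P" "card P = card (insert x S)"
    and Q: "disjoint_paths E (insert y S) J Q" "card Q = card (insert y S)"
  shows "\<exists>R. disjoint_paths (insert (x, y) E) I J R \<and> card R = card (insert x S)"
proof -
  have P_path: "path_between E I (insert x S) p" "distinct p" if "p \<in> P" for p
    using P that by (auto simp: disjoint_paths_def)
  have Q_path: "path_between E (insert y S) J q" "distinct q" if "q \<in> Q" for q
    using Q that by (auto simp: disjoint_paths_def)
  have last_P: "\<forall>p\<in>P. last p \<in> set p \<and> last p \<in> insert x S"
    using P_path by (simp add: path_between_def)
  have hd_Q: "\<forall>q\<in>Q. hd q \<in> set q \<and> hd q \<in> insert y S"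
    using Q_path by (simp add: path_between_def)
  note bijP = disjoint_paths_endpoint_bij[OF P finite.insertI[OF fin] last_P]
  note bijQ = disjoint_paths_endpoint_bij[OF Q finite.insertI[OF fin] hd_Q]
  \<comment> \<open>Following \<open>p\<close> up to \<open>z\<close> and then \<open>q\<close>
    gives a walk of \<open>E\<close>, which must hit \<open>S\<close>. A path of \<open>P\<close>
    has a point of \<open>S\<close> only at its last vertex and a path of \<open>Q\<close> only at
    its first, so the hit is \<open>z\<close>.\<close>
  have meet: "z \<in> S \<and> z = last p \<and> z = hd q"
    if "p \<in> P" "q \<in> Q" "z \<in> set p" "z \<in> set q" for p q z
  proof -
    obtain p1 p2 where p: "p = p1 @ z # p2" using \<open>z \<in> set p\<close> by (meson split_list)
    obtain q1 q2 where q: "q = q1 @ z # q2" using \<open>z \<in> set q\<close> by (meson split_list)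
    have "successively (\<lambda>a b. (a, b) \<in> E) (p1 @ z # q2)"
      using P_path(1)[OF \<open>p \<in> P\<close>] Q_path(1)[OF \<open>q \<in> Q\<close>]
      by (simp add: p q path_between_def successively_append_iff)
    moreover have "hd (p1 @ z # q2) \<in> I"
      using P_path(1)[OF \<open>p \<in> P\<close>] unfolding p path_between_def by (cases p1) auto
    moreover have "last (p1 @ z # q2) \<in> J"
      using Q_path(1)[OF \<open>q \<in> Q\<close>] unfolding q path_between_def by simp
    ultimately have "path_between E I J (p1 @ z # q2)"
      by (simp add: path_between_def)
    then obtain s where s: "s \<in> S" "s \<in> set p1 \<or> s = z \<or> s \<in> set q2"
      using S by (fastforce simp: separates_def)
    have last_eq: "s = last p" if "s \<in> set p" using bijP(2)[OF \<open>p \<in> P\<close> that] s(1) by simp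
    have hd_eq: "s = hd q" if "s \<in> set q" using bijQ(2)[OF \<open>q \<in> Q\<close> that] s(1) by simp
    have "s \<notin> set p1"
    proof
      assume "s \<in> set p1"
      then have "s = last p" using last_eq p by simp
      then have "s \<in> set (z # p2)" using p by (metis last_appendR last_in_set list.discI)
      then show False using \<open>s \<in> set p1\<close> P_path(2)[OF \<open>p \<in> P\<close>] p by auto
    qed
    moreover have "s \<notin> set q2"
    proof
      assume "s \<in> set q2"
      then have "s = hd q" using hd_eq q by simp
      then have "s \<in> set (q1 @ [z])" using q by (cases q1) auto
      then show False using \<open>s \<in> set q2\<close> Q_path(2)[OF \<open>q \<in> Q\<close>] q by auto
    qed
    ultimately have "s = z" using s by blast
    then show ?thesis using last_eq hd_eq s that by simp
  qed
  define \<alpha> where "\<alpha> = inv_into P last"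
  define \<beta> where "\<beta> = inv_into Q hd"
  have \<alpha>: "\<alpha> s \<in> P" "last (\<alpha> s) = s" if "s \<in> insert x S" for s
    using that bijP(1) unfolding \<alpha>_def bij_betw_def
    by (auto intro: inv_into_into f_inv_into_f simp del: insert_iff)
  have \<beta>: "\<beta> s \<in> Q" "hd (\<beta> s) = s" if "s \<in> insert y S" for s
    using that bijQ(1) unfolding \<beta>_def bij_betw_def
    by (auto intro: inv_into_into f_inv_into_f simp del: insert_iff)
  \<comment> \<open>\<open>m s\<close> is the start of the path of \<open>Q\<close> that continues
    \<open>\<alpha> s\<close>. It differs from \<open>s\<close> only at \<open>x\<close>, where the
    new arc is crossed.\<close>
  define m where "m s = (if s = x then y else s)" for s
  have m: "m s \<in> insert y S" if "s \<in> insert x S" for s using that by (auto simp: m_def)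
  \<comment> \<open>For \<open>s\<close> other than \<open>x\<close> the second path starts with
    \<open>s\<close> again, so that vertex is dropped.\<close>
  define g where "g s = \<alpha> s @ (if s = x then \<beta> y else tl (\<beta> s))" for s
  have set_g: "set (g s) \<subseteq> set (\<alpha> s) \<union> set (\<beta> (m s))" for s
    by (cases "\<beta> s") (auto simp: g_def m_def)
  have path_g: "path_between (insert (x, y) E) I J (g s) \<and> distinct (g s)"
    if s: "s \<in> insert x S" for s
  proof -
    note p = P_path[OF \<alpha>(1)[OF s]] and q = Q_path[OF \<beta>(1)[OF m[OF s]]]
    note p' = path_between_mono[OF p(1) subset_insertI[of _ "(x, y)"]]
      and q' = path_between_mono[OF q(1) subset_insertI[of _ "(x, y)"]]
    show ?thesis
    proof (cases "s = x")
      case True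
      then have "set (\<alpha> s) \<inter> set (\<beta> y) = {}"
        using meet[OF \<alpha>(1)[OF s] \<beta>(1)[OF m[OF s]]] \<alpha>(2)[OF s] xy by (auto simp: m_def)
      then show ?thesis
        using p p' q q' True \<alpha>(2)[OF s] \<beta>(2)[OF m[OF s]]
        by (auto simp: g_def m_def path_between_def successively_append_iff)
    next
      case False
      then have ms: "m s = s" by (simp add: m_def)
      then obtain t where t: "\<beta> s = s # t"
        using q \<beta>(2)[OF m[OF s]] by (cases "\<beta> s") (auto simp: path_between_def)
      then have "set (\<alpha> s) \<inter> set t = {}"
        using meet[OF \<alpha>(1)[OF s] \<beta>(1)[OF m[OF s]]] \<alpha>(2)[OF s] ms q by fastforce
      then show ?thesis
        using p p' q q' False \<alpha>(2)[OF s] t ms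
        by (cases t) (auto simp: g_def path_between_def successively_append_iff)
    qed
  qed
  have disj: "set (g s) \<inter> set (g t) = {}"
    if st: "s \<in> insert x S" "t \<in> insert x S" "s \<noteq> t" for s t
  proof -
    have "m s \<noteq> m t" using st xy by (auto simp: m_def split: if_splits)
    then have "\<beta> (m s) \<noteq> \<beta> (m t)" using \<beta>(2) m st by metis
    then have "set (\<beta> (m s)) \<inter> set (\<beta> (m t)) = {}"
      using Q(1) \<beta>(1) m st by (auto simp: disjoint_paths_def pairwise_def)
    moreover have "\<alpha> s \<noteq> \<alpha> t" using \<alpha>(2) st by metis
    then have "set (\<alpha> s) \<inter> set (\<alpha> t) = {}"
      using P(1) \<alpha>(1) st by (auto simp: disjoint_paths_def pairwise_def)
    moreover have cross: "set (\<alpha> u) \<inter> set (\<beta> (m v)) = {}"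
      if uv: "u \<in> insert x S" "v \<in> insert x S" "u \<noteq> v" for u v
    proof (rule ccontr)
      assume "set (\<alpha> u) \<inter> set (\<beta> (m v)) \<noteq> {}"
      then obtain z where "z \<in> set (\<alpha> u)" "z \<in> set (\<beta> (m v))" by blast
      from meet[OF \<alpha>(1)[OF uv(1)] \<beta>(1)[OF m[OF uv(2)]] this]
      have "u \<in> S" "u = m v" using \<alpha>(2)[OF uv(1)] \<beta>(2)[OF m[OF uv(2)]] by auto
      then show False using uv xy by (auto simp: m_def split: if_splits)
    qed
    ultimately show ?thesis
      using set_g[of s] set_g[of t] cross[OF st] cross[of t s] st by blast
  qed
  have "inj_on g (insert x S)"
  proof (rule inj_onI, rule ccontr)
    fix s t assume "s \<in> insert x S" "t \<in> insert x S" "g s = g t" "s \<noteq> t"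
    then show False using disj[of s t] path_g[of s] by (auto simp: path_between_def)
  qed
  then have "card (g ` insert x S) = card (insert x S)" by (rule card_image)
  moreover have "disjoint_paths (insert (x, y) E) I J (g ` insert x S)"
    unfolding disjoint_paths_def pairwise_def using path_g disj fin by fastforce
  ultimately show ?thesis by blast
qed

text \<open>Goering's induction on the arcs: if deleting an arc \<open>(x, y)\<close> creates a separator \<open>S\<close> that is
  too small, then both \<open>insert x S\<close> and \<open>insert y S\<close> are separators of size \<open>k\<close>, and the paths
  ending in the former are joined to the paths starting in the latter.\<close>

theorem vertex_menger:
  assumes "finite E" and "finite I" and "finite J"
    and "\<And>Z. finite Z \<Longrightarrow> separates E I J Z \<Longrightarrow> k \<le> card Z"
  shows "\<exists>P. disjoint_paths E I J P \<and> card P = k"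
  using assms
proof (induction E arbitrary: I J rule: finite_induct)
  case empty
  \<comment> \<open>Without arcs every path is a single vertex lying in both \<open>I\<close> and
    \<open>J\<close>.\<close>
  have "separates {} I J (I \<inter> J)"
    unfolding separates_def
  proof (intro allI impI)
    fix p assume p: "path_between {} I J p"
    then obtain a q where aq: "p = a # q" by (cases p) (auto simp: path_between_def)
    then have "q = []" using p by (cases q) (auto simp: path_between_def)
    then show "set p \<inter> (I \<inter> J) \<noteq> {}" using p aq by (auto simp: path_between_def)
  qed
  then have "k \<le> card (I \<inter> J)" using empty by simp
  then obtain K where K: "K \<subseteq> I \<inter> J" "card K = k" "finite K"
    using obtain_subset_with_card_n by metis
  then have "disjoint_paths {} I J ((\<lambda>v. [v]) ` K)"
    by (auto simp: disjoint_paths_def path_between_def pairwise_def)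
  moreover have "card ((\<lambda>v. [v]) ` K) = k" using K by (simp add: card_image inj_on_def)
  ultimately show ?case by blast
next
  case (insert e E)
  obtain x y where e: "e = (x, y)" by (cases e)
  show ?case
  proof (cases "\<forall>Z. finite Z \<longrightarrow> separates E I J Z \<longrightarrow> k \<le> card Z")
    case True
    then obtain P where "disjoint_paths E I J P" "card P = k"
      using insert.IH insert.prems by metis
    moreover from this have "disjoint_paths (insert e E) I J P"
      by (auto simp: disjoint_paths_def intro: path_between_mono)
    ultimately show ?thesis by blast
  next
    case False
    then obtain S where S: "finite S" "separates E I J S" "card S < k" by (meson not_le)
    note sx = separates_insert_source[OF S(2), of x y] and sy = separates_insert_target[OF S(2), of x y]
    have "k \<le> card (insert x S)" "k \<le> card (insert y S)"
      using sx sy insert.prems(3) S(1) e by auto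
    then have xy: "x \<notin> S" "y \<notin> S" "card (insert x S) = k" "card (insert y S) = k"
      using S by (auto simp: card_insert_if split: if_splits)
    obtain P where "disjoint_paths E I (insert x S) P" "card P = k"
      using insert.IH[of I "insert x S"] insert.prems S(1) e separates_first_half[OF sx] by auto
    moreover obtain Q where "disjoint_paths E (insert y S) J Q" "card Q = k"
      using insert.IH[of "insert y S" J] insert.prems S(1) e separates_second_half[OF sy] by auto
    ultimately show ?thesis using join_disjoint_paths[OF S(2,1) xy(1,2)] xy(3,4) e by metis
  qed
qed

section \<open>Trails as lists of oriented edges\<close>

lemma edge_reverse [simp]: "edge (reverse a) = edge a"
  and tail_reverse [simp]: "tail (reverse a) = head a"
  and head_reverse [simp]: "head (reverse a) = tail a"
  and reverse_reverse [simp]: "reverse (reverse a) = a"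
  by (cases a; simp)+

lemma minus_edge_sign [simp]: "- (- (s :: edge_sign)) = s" "s \<noteq> - s" "- s \<noteq> s"
  by (cases s; simp add: uminus_edge_sign_def)+

lemma edge_sign_neq_iff: "(s :: edge_sign) \<noteq> t \<longleftrightarrow> s = - t"
  by (cases s; cases t; simp add: uminus_edge_sign_def)

lemma reverse_in_oriented_edges [simp]: "reverse a \<in> oriented_edges B \<longleftrightarrow> a \<in> oriented_edges B"
  by (auto simp: oriented_edges_def)

lemma same_edge_cases:
  assumes "a \<in> oriented_edges B" "b \<in> oriented_edges B" "edge a = edge b"
  shows "a = b \<or> a = reverse b"
  using assms by (cases a; cases b) (auto simp: oriented_edges_def doubleton_eq_iff)

abbreviation edges_of :: "('v, 'e) oriented_edge list \<Rightarrow> 'e set" where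
  "edges_of p \<equiv> edge ` set p"

definition follows ::
    "('v, 'e) bigraph \<Rightarrow> ('v, 'e) oriented_edge \<Rightarrow> ('v, 'e) oriented_edge \<Rightarrow> bool" where
  "follows B a b \<longleftrightarrow> tail b = head a \<and> half_sign B (edge b) (head a) = - half_sign B (edge a) (head a)"

lemma follows_reverse: "follows B (reverse b) (reverse a) \<longleftrightarrow> follows B a b"
  unfolding follows_def by (metis edge_reverse head_reverse minus_edge_sign(1) tail_reverse)

text \<open>The ends are left out, so that trails can be cut, reversed and glued as plain
  lists.\<close>

definition trail_list :: "('v, 'e) bigraph \<Rightarrow> ('v, 'e) oriented_edge list \<Rightarrow> bool" where
  "trail_list B p \<longleftrightarrow>
     set p \<subseteq> oriented_edges B \<and> distinct (map edge p) \<and> successively (follows B) p"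

definition reverse_trail :: "('v, 'e) oriented_edge list \<Rightarrow> ('v, 'e) oriented_edge list" where
  "reverse_trail p = rev (map reverse p)"

lemma reverse_trail_simps [simp]:
  "reverse_trail [] = []"
  "reverse_trail (a # p) = reverse_trail p @ [reverse a]"
  "reverse_trail (p @ q) = reverse_trail q @ reverse_trail p"
  "set (reverse_trail p) = reverse ` set p"
  "edges_of (reverse_trail p) = edges_of p"
  by (auto simp: reverse_trail_def image_image)

lemma hd_reverse_trail: "p \<noteq> [] \<Longrightarrow> hd (reverse_trail p) = reverse (last p)"
  by (simp add: reverse_trail_def hd_rev last_map)

lemma trail_list_append:
  "trail_list B (p @ q) \<longleftrightarrow>
     trail_list B p \<and> trail_list B q \<and> edges_of p \<inter> edges_of q = {} \<and>
     (p \<noteq> [] \<longrightarrow> q \<noteq> [] \<longrightarrow> follows B (last p) (hd q))"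
  unfolding trail_list_def by (auto simp: successively_append_iff)

lemma trail_list_Nil [simp]: "trail_list B []"
  by (simp add: trail_list_def)

lemma trail_list_Cons:
  "trail_list B (a # q) \<longleftrightarrow>
     a \<in> oriented_edges B \<and> trail_list B q \<and> edge a \<notin> edges_of q \<and>
     (q \<noteq> [] \<longrightarrow> follows B a (hd q))"
  unfolding trail_list_def by (cases q) auto

lemma trail_list_reverse [simp]: "trail_list B (reverse_trail p) \<longleftrightarrow> trail_list B p"
proof (induction p)
  case (Cons a p)
  have "last (reverse_trail p) = reverse (hd p)" if "p \<noteq> []" using that by (cases p) auto
  moreover have "reverse_trail p \<noteq> [] \<longleftrightarrow> p \<noteq> []" by (simp add: reverse_trail_def)
  ultimately show ?case
    using Cons by (auto simp: trail_list_append trail_list_Cons follows_reverse image_iff)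
qed simp

text \<open>The two trails overlap in \<open>c\<close>, so the sign conditions on both sides of
  \<open>c\<close> are already known and only repetition of edges has to be excluded.\<close>

lemma trail_list_glue:
  assumes "trail_list B (p @ [c])" "trail_list B (c # q)" "edges_of p \<inter> edges_of q = {}"
  shows "trail_list B (p @ c # q)"
  using assms by (auto simp: trail_list_append trail_list_Cons)

lemma is_trail_iff:
  assumes "p \<noteq> []"
  shows "is_trail B v p w \<longleftrightarrow> v \<in> verts B \<and> trail_list B p \<and> tail (hd p) = v \<and> head (last p) = w"
  using assms by (auto simp: is_trail_def trail_list_def follows_def[abs_def])

section \<open>Reachability in edge-clean graphs\<close>

locale edge_clean_bidirected_graph = finite_rooted_bidirected_graph B r
  for B :: "('v, 'e) bigraph" and r :: 'v +
  assumes clean: "edge_clean B r"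
begin

abbreviation "reachable \<equiv> trail_reachable B r"
abbreviation "undirectable \<equiv> trail_undirectable B r"
abbreviation "OE \<equiv> oriented_edges B"

text \<open>Returns to the root are not forbidden here, which makes cutting and gluing easy;
  edge-cleanness will exclude them.\<close>

definition rooted_trail :: "('v, 'e) oriented_edge list \<Rightarrow> bool" where
  "rooted_trail p \<longleftrightarrow> p \<noteq> [] \<and> trail_list B p \<and> tail (hd p) = r"

lemma obtain_orientation:
  assumes "e \<in> edges B" "v \<in> ends B e"
  obtains a where "a \<in> OE" "edge a = e" "head a = v"
proof -
  obtain u w where uw: "ends B e = {u, w}" "u \<noteq> w" using loopless[OF assms(1)] by (meson card_2_iff)
  then have "Oriented u e w \<in> OE" "Oriented w e u \<in> OE"
    using assms by (auto simp: oriented_edges_def)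
  then show thesis using that uw assms(2) by (metis insertE oriented_edge.sel singletonD)
qed

lemma oriented_edge_ends:
  assumes "a \<in> OE"
  shows "edge a \<in> edges B" "ends B (edge a) = {tail a, head a}" "tail a \<noteq> head a"
  using assms by (auto simp: oriented_edges_def)

lemma reachable_root_trail:
  assumes "reachable a"
  obtains p where "rooted_trail p" "last p = a"
  using assms is_trail_iff unfolding trail_reachable_def is_root_trail_def rooted_trail_def by metis

lemma reachable_oriented: "reachable a \<Longrightarrow> a \<in> OE"
  by (elim reachable_root_trail) (auto simp: rooted_trail_def trail_list_def intro: last_in_set)

lemma undirectable_iff:
  assumes "a \<in> OE"
  shows "undirectable (edge a) \<longleftrightarrow> reachable a \<and> reachable (reverse a)"
proof
  assume "undirectable (edge a)"
  then obtain b where "b \<in> OE" "edge b = edge a" "reachable b" "reachable (reverse b)"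
    by (auto simp: trail_undirectable_def)
  then show "reachable a \<and> reachable (reverse a)" using same_edge_cases[OF assms] by fastforce
qed (use assms in \<open>auto simp: trail_undirectable_def\<close>)

lemma reachable_same_edge:
  assumes "reachable a" "reachable b" "edge a = edge b" "\<not> undirectable (edge a)"
  shows "a = b"
  using assms same_edge_cases reachable_oriented undirectable_iff by metis

lemma not_undirectable_root:
  assumes "a \<in> OE" "head a = r \<or> tail a = r"
  shows "\<not> undirectable (edge a)"
  using assms clean oriented_edge_ends[OF assms(1)] by (auto simp: edge_clean_def)

lemma reachable_from_root:
  assumes "a \<in> OE" "tail a = r"
  shows "reachable a"
  unfolding trail_reachable_def is_root_trail_def
  using assms root_vert
  by (intro exI[of _ "[a]"]) (auto simp: is_trail_iff trail_list_Cons)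

text \<open>An edge entering \<open>r\<close> can also be traversed out of \<open>r\<close> as a
  one-edge trail. Were it reachable, it would be undirectable and incident with the root.\<close>

lemma reachable_head_not_root:
  assumes "reachable a"
  shows "head a \<noteq> r"
proof
  assume "head a = r"
  moreover have a: "a \<in> OE" using assms by (rule reachable_oriented)
  ultimately have "undirectable (edge a)"
    using assms reachable_from_root[of "reverse a"] undirectable_iff[OF a] by simp
  then show False using not_undirectable_root[OF a] \<open>head a = r\<close> by simp
qed

text \<open>Edge-cleanness makes the condition on internal vertices of \<open>r\<close>-trails vacuous: a first
  return to \<open>r\<close> would run along an edge that can also be traversed out of \<open>r\<close>.\<close>

lemma rooted_trail_head_not_root:
  assumes "rooted_trail p" "a \<in> set p"
  shows "head a \<noteq> r"
proof
  assume "head a = r"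
  then obtain u c w where p: "p = u @ c # w" "head c = r" "\<forall>b\<in>set u. head b \<noteq> r"
    using split_list_first_prop[of p "\<lambda>b. head b = r"] assms(2) by blast
  have "trail_list B (u @ [c])" "tail (hd (u @ [c])) = r"
    using assms(1) unfolding p rooted_trail_def
    by (auto simp: trail_list_append trail_list_Cons hd_append)
  then have "is_root_trail B r (u @ [c])"
    using p root_vert by (auto simp: is_root_trail_def is_trail_iff)
  then have "reachable c" unfolding trail_reachable_def by force
  then show False using p reachable_head_not_root by blast
qed

lemma rooted_trail_last_reachable:
  assumes "rooted_trail p"
  shows "reachable (last p)"
proof -
  have "r \<notin> head ` set (butlast p)"
    using rooted_trail_head_not_root[OF assms] by (auto dest: in_set_butlastD)
  then have "is_root_trail B r p"
    using assms root_vert by (auto simp: is_root_trail_def is_trail_iff rooted_trail_def)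
  then show ?thesis using assms by (auto simp: trail_reachable_def rooted_trail_def)
qed

lemma rooted_trail_prefix:
  assumes "rooted_trail (p @ q)" "p \<noteq> []"
  shows "rooted_trail p"
  using assms by (auto simp: rooted_trail_def trail_list_append)

lemma rooted_trail_reachable:
  assumes "rooted_trail p" "a \<in> set p"
  shows "reachable a"
proof -
  obtain u w where "p = u @ a # w" using assms(2) by (meson split_list)
  then have "rooted_trail (u @ [a])" using assms(1) rooted_trail_prefix[of "u @ [a]" w] by simp
  from rooted_trail_last_reachable[OF this] show ?thesis by simp
qed

lemma rooted_trail_glue:
  assumes "rooted_trail (p @ [c])" "trail_list B (c # q)" "edges_of p \<inter> edges_of q = {}"
  shows "rooted_trail (p @ c # q)"
  using assms trail_list_glue[of B p c q] by (cases p) (auto simp: rooted_trail_def)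

lemma rooted_trail_append:
  assumes "rooted_trail p" "trail_list B q" "edges_of p \<inter> edges_of q = {}"
    and "q \<noteq> []" "follows B (last p) (hd q)"
  shows "rooted_trail (p @ q)"
  using assms by (auto simp: rooted_trail_def trail_list_append)

lemma rooted_trail_snoc:
  assumes "rooted_trail p" "b \<in> OE" "edge b \<notin> edges_of p" "follows B (last p) b"
  shows "rooted_trail (p @ [b])"
  using assms by (intro rooted_trail_append) (auto simp: trail_list_Cons)

section \<open>Arcs and blossoms\<close>

definition arc :: "('v, 'e) oriented_edge \<Rightarrow> bool" where
  "arc f \<longleftrightarrow> reachable f \<and> \<not> undirectable (edge f)"

lemma arc_same_edge: "arc a \<Longrightarrow> reachable b \<Longrightarrow> edge a = edge b \<Longrightarrow> a = b"
  by (auto simp: arc_def dest: reachable_same_edge)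

lemma arc_reverse_not_reachable: "arc f \<Longrightarrow> \<not> reachable (reverse f)"
  using undirectable_iff reachable_oriented arc_def by metis

text \<open>Quantifying over oriented edges covers both directions, because \<open>a\<close> and
  \<open>reverse a\<close> have the same edge.\<close>

definition two_way :: "('v, 'e) oriented_edge \<Rightarrow> 'e set \<Rightarrow> bool" where
  "two_way f S \<longleftrightarrow> S \<subseteq> edges B \<and> edge f \<notin> S \<and>
     (\<forall>a\<in>OE. edge a \<in> S \<longrightarrow> (\<exists>T. trail_list B (f # T @ [a]) \<and> edges_of T \<subseteq> S))"

definition blossom :: "('v, 'e) oriented_edge \<Rightarrow> 'e set" where
  "blossom f = \<Union>{S. two_way f S}"

text \<open>Two-way sets are closed under union: a witnessing trail inside one member also lies
  inside the union. Hence a largest one exists.\<close>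

lemma two_way_blossom: "two_way f (blossom f)"
  unfolding two_way_def
proof (intro conjI ballI impI)
  fix a assume "a \<in> OE" "edge a \<in> blossom f"
  then obtain S where S: "two_way f S" "edge a \<in> S" by (auto simp: blossom_def)
  with \<open>a \<in> OE\<close> obtain T where "trail_list B (f # T @ [a])" "edges_of T \<subseteq> S"
    by (auto simp: two_way_def)
  moreover from S have "S \<subseteq> blossom f" by (auto simp: blossom_def)
  ultimately show "\<exists>T. trail_list B (f # T @ [a]) \<and> edges_of T \<subseteq> blossom f" by blast
qed (auto simp: blossom_def two_way_def)

lemma blossom_maximal: "two_way f S \<Longrightarrow> S \<subseteq> blossom f"
  by (auto simp: blossom_def)

lemma blossom_edges: "blossom f \<subseteq> edges B"
  and not_in_blossom: "edge f \<notin> blossom f"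
  using two_way_blossom by (auto simp: two_way_def)

lemma blossom_trail:
  assumes "a \<in> OE" "edge a \<in> blossom f"
  obtains T where "trail_list B (f # T @ [a])" "edges_of T \<subseteq> blossom f"
  using assms two_way_blossom[of f] unfolding two_way_def by blast

text \<open>A trail that enters the blossom of \<open>f\<close> without having used \<open>f\<close> could leave it through \<open>f\<close>
  backwards.\<close>

lemma no_back_door:
  assumes "arc f" "rooted_trail (p @ [c])" "edge c \<in> blossom f"
    and "edges_of p \<inter> insert (edge f) (blossom f) = {}"
  shows False
proof -
  have "c \<in> OE" using assms(2) by (auto simp: rooted_trail_def trail_list_def)
  then obtain T where T: "trail_list B (f # T @ [reverse c])" "edges_of T \<subseteq> blossom f"
    using assms(3) blossom_trail[of "reverse c" f] by auto
  then have "trail_list B (reverse_trail (f # T @ [reverse c]))" by (simp only: trail_list_reverse)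
  then have "trail_list B (c # reverse_trail T @ [reverse f])" by simp
  moreover have "edges_of p \<inter> edges_of (reverse_trail T @ [reverse f]) = {}"
    using T(2) assms(4) by (auto simp: image_image)
  ultimately have "rooted_trail (p @ c # reverse_trail T @ [reverse f])"
    using assms(2) rooted_trail_glue by blast
  from rooted_trail_last_reachable[OF this] show False
    using arc_reverse_not_reachable[OF assms(1)] by simp
qed

lemma trail_to_arc_avoids_blossom:
  assumes "arc f" "rooted_trail p" "last p = f"
  shows "edges_of p \<inter> blossom f = {}"
proof (rule ccontr)
  assume "edges_of p \<inter> blossom f \<noteq> {}"
  then obtain u c w where p: "p = u @ c # w" "edge c \<in> blossom f" "\<forall>b\<in>set u. edge b \<notin> blossom f"
    using split_list_first_prop[of p "\<lambda>b. edge b \<in> blossom f"] by blast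
  have "w \<noteq> []" using assms(3) p not_in_blossom[of f] by auto
  then have "f \<in> set w" using assms(3) p by (auto simp: last_in_set split: if_splits)
  then have "edge f \<notin> edges_of u"
    using assms(2) unfolding rooted_trail_def p trail_list_def by (auto simp: image_iff)
  then have "edges_of u \<inter> insert (edge f) (blossom f) = {}" using p by auto
  moreover have "rooted_trail (u @ [c])" using assms(2) rooted_trail_prefix[of "u @ [c]" w] p by simp
  ultimately show False using no_back_door[OF assms(1) _ p(2)] by blast
qed

text \<open>Edges cannot repeat, since a trail to \<open>f\<close> is disjoint from the blossom.
  Thus every trail inside the blossom can be prolonged back to the root.\<close>

lemma rooted_trail_into_blossom:
  assumes "arc f" "rooted_trail p" "last p = f" "trail_list B (f # T)" "edges_of T \<subseteq> blossom f"
  shows "rooted_trail (p @ T)"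
proof -
  have p: "p = butlast p @ [f]" using assms(2,3) by (auto simp: rooted_trail_def)
  have "edges_of (butlast p) \<inter> edges_of T = {}"
    using trail_to_arc_avoids_blossom[OF assms(1-3)] assms(5) by (auto dest: in_set_butlastD)
  then have "rooted_trail (butlast p @ f # T)"
    using rooted_trail_glue[of "butlast p" f T] p assms(2,4) by simp
  then show ?thesis using p by (metis append.assoc append_Cons append_Nil)
qed

lemma blossom_reachable:
  assumes "arc f" "a \<in> OE" "edge a \<in> blossom f"
  shows "reachable a"
proof -
  obtain T where T: "trail_list B (f # T @ [a])" "edges_of T \<subseteq> blossom f"
    using blossom_trail assms by blast
  obtain p where "rooted_trail p" "last p = f"
    using assms(1) reachable_root_trail unfolding arc_def by blast
  then have "rooted_trail (p @ T @ [a])"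
    using assms rooted_trail_into_blossom[of f p "T @ [a]"] T by simp
  from rooted_trail_last_reachable[OF this] show ?thesis by simp
qed

lemma blossom_undirectable:
  assumes "arc f" "e \<in> blossom f"
  shows "undirectable e"
proof -
  have "e \<in> edges B" using blossom_edges assms by auto
  then obtain v where "v \<in> ends B e" using loopless by fastforce
  then obtain a where "a \<in> OE" "edge a = e" using obtain_orientation \<open>e \<in> edges B\<close> by blast
  then show ?thesis
    using assms undirectable_iff blossom_reachable[of f a] blossom_reachable[of f "reverse a"] by auto
qed

lemma arc_not_in_blossom: "arc f \<Longrightarrow> arc g \<Longrightarrow> edge g \<notin> blossom f"
  using blossom_undirectable arc_def by blast

text \<open>A trail \<open>Q\<close> reaching the new edge \<open>a\<close> backwards must meet \<open>f\<close> or the blossom; its part after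
  the last such meeting, together with \<open>a\<close>, closes up with \<open>f # T\<close> and can be added to the
  blossom.\<close>

lemma undirectable_continuation_step:
  assumes f: "arc f" and fTe: "trail_list B (f # T @ [a])" and T: "edges_of T \<subseteq> blossom f"
    and U: "undirectable (edge a)"
  shows "edge a \<in> blossom f"
proof (rule ccontr)
  assume new: "edge a \<notin> blossom f"
  have OE: "a \<in> OE" "f \<in> OE" and af: "edge a \<noteq> edge f"
    using fTe by (auto simp: trail_list_def)
  from U obtain Q0 where "rooted_trail Q0" "last Q0 = reverse a"
    using undirectable_iff[OF OE(1)] reachable_root_trail by metis
  then obtain Q where Q: "rooted_trail (Q @ [reverse a])"
    by (metis append_butlast_last_id rooted_trail_def)
  have aQ: "edge a \<notin> edges_of Q"
    using Q by (auto simp: rooted_trail_def trail_list_append)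
  have backward: "trail_list B (reverse a # reverse_trail T @ [reverse f])"
    using fTe trail_list_reverse[of B "f # T @ [a]"] by simp
  let ?K = "insert (edge f) (blossom f)"
  \<comment> \<open>Otherwise \<open>Q\<close> could be continued by the reversal of
    \<open>f # T @ [a]\<close> and would traverse \<open>f\<close> backwards.\<close>
  have "\<exists>c\<in>set Q. edge c \<in> ?K"
  proof (rule ccontr)
    assume "\<not> ?thesis"
    then have "edges_of Q \<inter> edges_of (reverse_trail T @ [reverse f]) = {}"
      using T by (auto simp: image_image)
    from rooted_trail_glue[OF Q backward this] have "rooted_trail (Q @ reverse a # reverse_trail T @ [reverse f])" .
    from rooted_trail_last_reachable[OF this] show False
      using arc_reverse_not_reachable[OF f] by simp
  qed
  then obtain Q1 c Q2 where split: "Q = Q1 @ c # Q2" "edge c \<in> ?K" "\<forall>b\<in>set Q2. edge b \<notin> ?K"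
    using split_list_last_prop[of Q "\<lambda>c. edge c \<in> ?K"] by blast
  have cQ2: "trail_list B (c # Q2 @ [reverse a])"
    using Q split unfolding rooted_trail_def by (auto simp: trail_list_append)
  have Q2K: "edges_of Q2 \<inter> ?K = {}" using split(3) by blast
  \<comment> \<open>This leads from \<open>f\<close> to \<open>c\<close> within the blossom. If
    \<open>c\<close> runs along \<open>f\<close>, it equals \<open>f\<close> because an arc is
    reachable in one direction only, and \<open>W\<close> is empty.\<close>
  have "\<exists>W. trail_list B (W @ [c]) \<and> hd (W @ [c]) = f \<and> edges_of (tl (W @ [c])) \<subseteq> blossom f"
  proof (cases "edge c = edge f")
    case True
    have "reachable c" using rooted_trail_reachable[OF Q] split by auto
    then have "c = f" using arc_same_edge[OF f] True by metis
    then show ?thesis using OE by (intro exI[of _ "[]"]) (auto simp: trail_list_Cons)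
  next
    case False
    then have "edge c \<in> blossom f" using split by auto
    moreover have "c \<in> OE" using cQ2 by (auto simp: trail_list_def)
    ultimately obtain T' where "trail_list B (f # T' @ [c])" "edges_of T' \<subseteq> blossom f"
      using blossom_trail by metis
    then show ?thesis using \<open>edge c \<in> blossom f\<close> by (intro exI[of _ "f # T'"]) auto
  qed
  then obtain W where W: "trail_list B (W @ [c])" "hd (W @ [c]) = f"
    "edges_of (tl (W @ [c])) \<subseteq> blossom f" by blast
  have WK: "edges_of (W @ [c]) \<subseteq> ?K"
    using W(2,3) by (cases "W @ [c]") auto
  \<comment> \<open>First way round the new cycle: through the blossom to \<open>c\<close>, along
    \<open>Q2\<close>, and over \<open>a\<close> backwards.\<close>
  have forward: "trail_list B (W @ c # Q2 @ [reverse a])"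
  proof (rule trail_list_glue[OF W(1) cQ2])
    have "edges_of (Q2 @ [reverse a]) \<inter> ?K = {}" using Q2K new af by simp
    moreover have "edges_of W \<subseteq> ?K" using WK by simp
    ultimately show "edges_of W \<inter> edges_of (Q2 @ [reverse a]) = {}" by blast
  qed
  obtain W' where W': "W @ [c] = f # W'" using W(2) by (cases "W @ [c]") auto
  have W'K: "edges_of W' \<subseteq> blossom f" using W(3) W' by simp
  have forward': "trail_list B (f # W' @ Q2 @ [reverse a])"
  proof -
    have "W @ c # Q2 @ [reverse a] = (W @ [c]) @ Q2 @ [reverse a]" by simp
    then show ?thesis using forward by (simp only: W' append_Cons)
  qed
  \<comment> \<open>Second way round: through \<open>T\<close>, over \<open>a\<close>, and back
    along \<open>Q2\<close>.\<close>
  have ret: "trail_list B (f # T @ a # reverse_trail Q2)"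
  proof -
    have "trail_list B (Q2 @ [reverse a])" using cQ2 by (auto simp: trail_list_Cons)
    then have "trail_list B (reverse_trail (Q2 @ [reverse a]))" by (simp only: trail_list_reverse)
    then have "trail_list B (a # reverse_trail Q2)" by simp
    moreover have "edges_of (f # T) \<inter> edges_of (reverse_trail Q2) = {}"
    proof -
      have "edges_of (f # T) \<subseteq> ?K" using T by auto
      moreover have "edges_of (reverse_trail Q2) \<inter> ?K = {}"
        using Q2K by (subst reverse_trail_simps(5))
      ultimately show ?thesis by (meson disjoint_iff subsetD)
    qed
    ultimately show ?thesis using trail_list_glue[of B "f # T" a "reverse_trail Q2"] fTe by simp
  qed
  \<comment> \<open>Initial segments of the two ways round reach \<open>a\<close> and every edge of
    \<open>Q2\<close> in both directions, so the blossom can be enlarged, against its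
    maximality.\<close>
  let ?S = "insert (edge a) (blossom f \<union> edges_of Q2)"
  have "two_way f ?S"
    unfolding two_way_def
  proof (intro conjI ballI impI)
    show "?S \<subseteq> edges B"
      using blossom_edges cQ2 OE by (auto simp: trail_list_def oriented_edges_def)
    show "edge f \<notin> ?S" using af Q2K not_in_blossom by auto
    fix b assume b: "b \<in> OE" "edge b \<in> ?S"
    consider "edge b \<in> blossom f" | "edge b = edge a" | d where "d \<in> set Q2" "edge b = edge d"
      using b by auto
    then show "\<exists>T. trail_list B (f # T @ [b]) \<and> edges_of T \<subseteq> ?S"
    proof cases
      case 1
      with b(1) obtain T' where "trail_list B (f # T' @ [b])" "edges_of T' \<subseteq> blossom f"
        by (rule blossom_trail)
      then show ?thesis by (intro exI[of _ T'] conjI) auto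
    next
      case 2
      from same_edge_cases[OF b(1) OE(1) 2] consider "b = a" | "b = reverse a" by blast
      then show ?thesis
      proof cases
        case 1
        then show ?thesis using fTe T by (intro exI[of _ T] conjI) auto
      next
        case 2
        then show ?thesis using forward' W'K by (intro exI[of _ "W' @ Q2"] conjI) auto
      qed
    next
      case 3
      then obtain u w where uw: "Q2 = u @ d # w" by (meson split_list)
      have "d \<in> OE" using cQ2 3 by (auto simp: trail_list_def)
      from same_edge_cases[OF b(1) this 3(2)] consider "b = d" | "b = reverse d" by blast
      then show ?thesis
      proof cases
        case 1
        have "trail_list B ((f # W' @ u @ [d]) @ w @ [reverse a])" using forward' uw by simp
        then have "trail_list B (f # W' @ u @ [d])" by (simp only: trail_list_append)
        then show ?thesis using 1 W'K uw by (intro exI[of _ "W' @ u"] conjI) auto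
      next
        case 2
        have "trail_list B ((f # T @ a # reverse_trail w @ [reverse d]) @ reverse_trail u)"
          using ret uw by simp
        then have "trail_list B (f # T @ a # reverse_trail w @ [reverse d])"
          by (simp only: trail_list_append)
        then show ?thesis
          using 2 T uw by (intro exI[of _ "T @ a # reverse_trail w"]) (auto simp: image_image)
      qed
    qed
  qed
  then show False using blossom_maximal new by blast
qed

lemma undirectable_continuation:
  assumes f: "arc f" and "trail_list B (f # T)" and "\<And>a. a \<in> set T \<Longrightarrow> undirectable (edge a)"
  shows "edges_of T \<subseteq> blossom f"
  using assms(2,3)
proof (induction T rule: rev_induct)
  case (snoc a T)
  have "trail_list B ((f # T) @ [a])" using snoc.prems by simp
  then have "trail_list B (f # T)" by (simp only: trail_list_append)
  then have "edges_of T \<subseteq> blossom f" using snoc by simp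
  then show ?case using undirectable_continuation_step[OF f] snoc.prems by simp
qed simp

text \<open>On a trail to \<open>a\<close>, take the last edge \<open>f\<close> that is not
  undirectable; the first edge is one, as it is incident with \<open>r\<close>. Everything after
  \<open>f\<close> stays in its blossom.\<close>

lemma undirectable_in_blossom:
  assumes "reachable a" "undirectable (edge a)"
  obtains f where "arc f" "edge a \<in> blossom f"
proof -
  obtain p where p: "rooted_trail p" "last p = a" using assms reachable_root_trail by blast
  then have "p \<noteq> []" by (simp add: rooted_trail_def)
  have "\<not> undirectable (edge (hd p))"
    using p \<open>p \<noteq> []\<close> not_undirectable_root[of "hd p"] hd_in_set[of p]
    by (auto simp: rooted_trail_def trail_list_def simp del: hd_in_set)
  then have "\<exists>f\<in>set p. \<not> undirectable (edge f)" using \<open>p \<noteq> []\<close> by auto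
  then obtain u f w where split: "p = u @ f # w" "\<not> undirectable (edge f)"
    "\<forall>b\<in>set w. undirectable (edge b)"
    using split_list_last_prop[of p "\<lambda>b. \<not> undirectable (edge b)"] by blast
  have "arc f" using rooted_trail_reachable[OF p(1)] split by (auto simp: arc_def)
  moreover have "trail_list B (f # w)"
    using p split by (simp add: rooted_trail_def trail_list_append)
  ultimately have "edges_of w \<subseteq> blossom f" using undirectable_continuation split by blast
  moreover have "w \<noteq> []" using assms p split by auto
  then have "a \<in> set w" using p split by (auto simp: last_in_set)
  ultimately show thesis using that \<open>arc f\<close> by blast
qed

section \<open>Entrances and exits of blossoms\<close>

definition blossom_verts :: "('v, 'e) oriented_edge \<Rightarrow> 'v set" where
  "blossom_verts f = \<Union> (ends B ` blossom f)"

lemma blossom_verts_ends: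
  assumes "a \<in> OE" "edge a \<in> blossom f"
  shows "tail a \<in> blossom_verts f" "head a \<in> blossom_verts f"
  using assms oriented_edge_ends(2)[OF assms(1)] by (auto simp: blossom_verts_def)

text \<open>An edge of the blossom can be traversed both towards and away from any of its ends, so the
  two resulting trails arrive there with opposite signs.\<close>

lemma blossom_exit:
  assumes "tail b \<in> blossom_verts f"
  obtains T where "trail_list B (f # T)" "edges_of T \<subseteq> blossom f" "follows B (last (f # T)) b"
proof -
  obtain e where e: "e \<in> blossom f" "tail b \<in> ends B e" using assms by (auto simp: blossom_verts_def)
  then obtain a where a: "a \<in> OE" "edge a = e" "head a = tail b"
    using obtain_orientation[of e "tail b"] blossom_edges by blast
  show thesis
  proof (cases "follows B a b")
    case True
    moreover obtain T where "trail_list B (f # T @ [a])" "edges_of T \<subseteq> blossom f"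
      using blossom_trail[of a f] a e by auto
    ultimately show thesis using that[of "T @ [a]"] a e by simp
  next
    case False
    \<comment> \<open>Dropping the final \<open>reverse a\<close> leaves a trail that arrives at the
      same vertex with the sign opposite to that of \<open>a\<close>. Its last edge may be
      \<open>f\<close> itself.\<close>
    obtain T where T: "trail_list B (f # T @ [reverse a])" "edges_of T \<subseteq> blossom f"
      using blossom_trail[of "reverse a" f] a e by auto
    then have "trail_list B ((f # T) @ [reverse a])" by simp
    then have "trail_list B (f # T)" "follows B (last (f # T)) (reverse a)"
      unfolding trail_list_append by auto
    moreover have "half_sign B (edge b) (head a) \<noteq> - half_sign B e (head a)"
      using False a by (auto simp: follows_def)
    then have "half_sign B (edge b) (head a) = half_sign B e (head a)"
      by (simp add: edge_sign_neq_iff)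
    ultimately have "follows B (last (f # T)) b"
      using a by (auto simp: follows_def)
    then show thesis using that[of T] \<open>trail_list B (f # T)\<close> T by simp
  qed
qed

text \<open>At a vertex of the blossom some trail \<open>f # T\<close> can be continued by
  \<open>reverse h\<close>. Its reversal can then be appended after \<open>h\<close> and would
  traverse \<open>f\<close> backwards.\<close>

lemma trail_avoiding_blossom_edges_avoids_verts:
  assumes f: "arc f" and q: "rooted_trail (q @ [h])"
    and disj: "edges_of (q @ [h]) \<inter> insert (edge f) (blossom f) = {}"
  shows "head h \<notin> blossom_verts f"
proof
  assume "head h \<in> blossom_verts f"
  then obtain T where T: "trail_list B (f # T)" "edges_of T \<subseteq> blossom f"
    "follows B (last (f # T)) (reverse h)"
    using blossom_exit[of "reverse h" f] by auto
  have "follows B h (hd (reverse_trail (f # T)))"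
    using T(3) follows_reverse[of B "reverse (last (f # T))" h]
    by (simp only: hd_reverse_trail list.discI reverse_reverse simp_thms)
  moreover have "trail_list B (reverse_trail (f # T))" using T(1) by (simp only: trail_list_reverse)
  moreover have "edges_of (q @ [h]) \<inter> edges_of (reverse_trail (f # T)) = {}"
  proof -
    have "edges_of (reverse_trail (f # T)) \<subseteq> insert (edge f) (blossom f)"
      using T(2) by (auto simp: image_image)
    then show ?thesis using disj by blast
  qed
  ultimately have "rooted_trail ((q @ [h]) @ reverse_trail (f # T))"
    by (intro rooted_trail_append[OF q]) auto
  from rooted_trail_last_reachable[OF this] show False
    using arc_reverse_not_reachable[OF f] by simp
qed

text \<open>Consider a trail \<open>P\<close> to \<open>f\<close>. If it uses the edge of
  \<open>g\<close> in either direction, a part before \<open>f\<close> already arrives at the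
  blossom, which is impossible. Otherwise \<open>P\<close> can be prolonged through the blossom and
  out by \<open>reverse g\<close>; then \<open>g\<close> is undirectable and belongs to the blossom
  by maximality.\<close>

lemma unique_blossom_entrance:
  assumes f: "arc f" and g: "reachable g" and v: "head g \<in> blossom_verts f"
    and out: "edge g \<notin> blossom f"
  shows "g = f"
proof (rule ccontr)
  assume "g \<noteq> f"
  then have gf: "edge g \<noteq> edge f" using arc_same_edge[OF f g] by auto
  obtain P where P: "rooted_trail P" "last P = f" using f reachable_root_trail arc_def by blast
  note avoid = trail_to_arc_avoids_blossom[OF f P]
  have distinct: "distinct (map edge P)" using P by (simp add: rooted_trail_def trail_list_def)
  have g_OE: "g \<in> OE" using g by (rule reachable_oriented)
  have prefix: False if "P = u @ [h] @ w" "head h = head g" "w \<noteq> []" for u h w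
  proof -
    have "edge f \<in> edges_of w" using P(2) that by (auto simp: last_in_set)
    then have "edge f \<notin> edges_of (u @ [h])" using distinct that by auto
    then have "edges_of (u @ [h]) \<inter> insert (edge f) (blossom f) = {}" using avoid that by auto
    moreover have "rooted_trail (u @ [h])" using P(1) that rooted_trail_prefix[of "u @ [h]" w] by simp
    ultimately show False using trail_avoiding_blossom_edges_avoids_verts[OF f] v that by metis
  qed
  show False
  proof (cases "edge g \<in> edges_of P")
    case True
    then obtain c where c: "c \<in> set P" "edge c = edge g" by auto
    then obtain u w where split: "P = u @ c # w" by (meson split_list)
    have w: "w \<noteq> []" using P(2) split c gf by auto
    have "c \<in> OE" using c P by (auto simp: rooted_trail_def trail_list_def)
    then consider "c = g" | "c = reverse g" using same_edge_cases[OF _ g_OE c(2)] by blast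
    then show False
    proof cases
      case 1
      then show False using prefix[of u c w] split w by simp
    next
      case 2
      \<comment> \<open>If \<open>P\<close> runs along \<open>g\<close> backwards, the edge before
        it arrives at \<open>head g\<close>. There is such an edge because \<open>head g\<close> is
        not the root.\<close>
      have "u \<noteq> []"
        using P(1) split 2 reachable_head_not_root[OF g] by (auto simp: rooted_trail_def)
      then obtain u' h where u: "u = u' @ [h]" by (metis append_butlast_last_id)
      then have "follows B h c"
        using P(1) unfolding split u rooted_trail_def trail_list_append by auto
      then have "head h = head g" using 2 by (simp add: follows_def)
      then show False using prefix[of u' h "c # w"] split u by simp
    qed
  next
    case False
    obtain T where T: "trail_list B (f # T)" "edges_of T \<subseteq> blossom f"
      "follows B (last (f # T)) (reverse g)"
      using blossom_exit[of "reverse g" f] v by auto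
    have "edge g \<notin> edges_of (f # T)" using T(2) gf out by auto
    then have fTg: "trail_list B ((f # T) @ [reverse g])"
      unfolding trail_list_append using T g_OE by (simp add: trail_list_Cons)
    have PT: "rooted_trail (P @ T)" using rooted_trail_into_blossom[OF f P T(1,2)] .
    moreover have "last (P @ T) = last (f # T)" using P by (simp add: rooted_trail_def)
    moreover have "edge g \<notin> edges_of (P @ T)" using T(2) out False by auto
    ultimately have "rooted_trail ((P @ T) @ [reverse g])"
      using T(3) g_OE rooted_trail_snoc[of "P @ T" "reverse g"] by simp
    from rooted_trail_last_reachable[OF this] have "undirectable (edge g)"
      using undirectable_iff[OF g_OE] g by simp
    then have "edge (reverse g) \<in> blossom f"
      using undirectable_continuation_step[OF f, of T "reverse g"] fTg T by simp
    then show False using out by simp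
  qed
qed

text \<open>Walking from \<open>f\<close> inside its blossom to a shared edge, the edge
  \<open>h\<close> just before the first edge of the blossom of \<open>g\<close> enters that blossom
  from outside. So \<open>h\<close> is \<open>g\<close>, and being an arc it can only be
  \<open>f\<close>.\<close>

lemma blossoms_disjoint:
  assumes f: "arc f" and g: "arc g" and "blossom f \<inter> blossom g \<noteq> {}"
  shows "f = g"
proof -
  obtain e where e: "e \<in> blossom f" "e \<in> blossom g" using assms by blast
  then have "e \<in> edges B" using blossom_edges by blast
  moreover from this obtain v where "v \<in> ends B e" using loopless by fastforce
  ultimately obtain a where a: "a \<in> OE" "edge a = e" using obtain_orientation by blast
  then obtain T where T: "trail_list B (f # T @ [a])" "edges_of T \<subseteq> blossom f"
    using blossom_trail e by metis
  obtain u c w where split: "T @ [a] = u @ c # w" "edge c \<in> blossom g"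
    "\<forall>b\<in>set u. edge b \<notin> blossom g"
    using split_list_first_prop[of "T @ [a]" "\<lambda>b. edge b \<in> blossom g"] a e by auto
  have tr: "trail_list B ((f # u) @ c # w)" using T split by simp
  have sub: "edges_of (T @ [a]) \<subseteq> blossom f" using T(2) a e by simp
  define h where "h = last (f # u)"
  have h: "h \<in> set (f # u)" unfolding h_def by (rule last_in_set) simp
  have hf: "h = f \<or> edge h \<in> blossom f" using h sub split by auto
  have OE: "h \<in> OE" "c \<in> OE" using tr h by (auto simp: trail_list_def)
  then have "reachable h" using hf blossom_reachable[OF f] f arc_def by metis
  moreover have "edge h \<notin> blossom g" using h split arc_not_in_blossom[OF g f] by auto
  moreover have "head h = tail c"
    using tr unfolding trail_list_append h_def follows_def by simp
  then have "head h \<in> blossom_verts g" using blossom_verts_ends[OF OE(2) split(2)] by simp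
  ultimately have "h = g" using unique_blossom_entrance[OF g] by blast
  then show ?thesis using hf arc_not_in_blossom[OF f g] by auto
qed

lemma arc_blossom_disjoint:
  assumes "arc f" "arc g" "f \<noteq> g"
  shows "insert (edge f) (blossom f) \<inter> insert (edge g) (blossom g) = {}"
proof -
  have "edge f \<noteq> edge g" using assms arc_same_edge[of f g] by (auto simp: arc_def)
  moreover have "blossom f \<inter> blossom g = {}" using assms blossoms_disjoint by blast
  moreover have "edge f \<notin> blossom g" "edge g \<notin> blossom f" using assms arc_not_in_blossom by blast+
  ultimately show ?thesis by simp
qed

section \<open>The digraph of arcs\<close>

definition arc_step :: "('v, 'e) oriented_edge \<Rightarrow> ('v, 'e) oriented_edge \<Rightarrow> bool" where
  "arc_step a b \<longleftrightarrow> (\<exists>T. edges_of T \<subseteq> blossom a \<and> trail_list B (a # T @ [b]))"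

text \<open>These are the possible ends of a detour after \<open>a\<close>. The head is inserted
  because the blossom may be empty.\<close>

definition arc_verts :: "('v, 'e) oriented_edge \<Rightarrow> 'v set" where
  "arc_verts a = insert (head a) (blossom_verts a)"

text \<open>From a vertex of the blossom, both signs are available. Elsewhere only arcs arrive at
  \<open>head a\<close>, and two arcs arriving there with opposite signs could be continued into
  each other, making one of them traversable backwards.\<close>

lemma arc_step_intro:
  assumes a: "arc a" and b: "arc b" and "a \<noteq> b" and u: "tail b \<in> arc_verts a"
  shows "arc_step a b"
proof -
  have ab: "edge a \<noteq> edge b" using assms arc_same_edge[of a b] arc_def by auto
  have OE: "a \<in> OE" "b \<in> OE" using a b reachable_oriented arc_def by auto
  show ?thesis
  proof (cases "tail b \<in> blossom_verts a")
    case True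
    then obtain T where T: "trail_list B (a # T)" "edges_of T \<subseteq> blossom a"
      "follows B (last (a # T)) b"
      by (rule blossom_exit)
    have "edge b \<notin> edges_of (a # T)" using T(2) ab arc_not_in_blossom[OF a b] by auto
    then have "trail_list B ((a # T) @ [b])"
      unfolding trail_list_append using T OE by (simp add: trail_list_Cons)
    then show ?thesis using T(2) by (auto simp: arc_step_def)
  next
    case False
    then have u: "tail b = head a" "head a \<notin> blossom_verts a" using u by (auto simp: arc_verts_def)
    \<comment> \<open>The edge \<open>c\<close> would lie in a blossom that \<open>a\<close> enters
      from outside. That blossom would be the one of \<open>a\<close>, whose vertices do not include
      \<open>head a\<close>.\<close>
    have no_undirectable: False
      if c: "c \<in> OE" "undirectable (edge c)" "head c = head a" for c
    proof -
      have "reachable c" using c undirectable_iff by blast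
      then obtain h where h: "arc h" "edge c \<in> blossom h"
        using undirectable_in_blossom[OF _ c(2)] by blast
      then have "head a \<in> blossom_verts h" using blossom_verts_ends c by metis
      then have "a = h"
        using unique_blossom_entrance[OF h(1)] a arc_not_in_blossom[OF h(1) a] arc_def by blast
      then show False using u \<open>head a \<in> blossom_verts h\<close> by simp
    qed
    obtain P where P: "rooted_trail P" "last P = b" using b reachable_root_trail arc_def by blast
    then obtain P' where P': "P = P' @ [b]" by (metis append_butlast_last_id rooted_trail_def)
    have "tail b \<noteq> r" using u reachable_head_not_root a arc_def by metis
    then have "P' \<noteq> []" using P P' by (auto simp: rooted_trail_def)
    then obtain P'' h where P'': "P' = P'' @ [h]" by (metis append_butlast_last_id)
    have hb: "follows B h b" using P(1) unfolding P' P'' rooted_trail_def trail_list_append by auto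
    have rh: "rooted_trail (P'' @ [h])" using P(1) P' P'' rooted_trail_prefix[of P' "[b]"] by simp
    have h: "reachable h" "h \<in> OE"
      using rooted_trail_last_reachable[OF rh] reachable_oriented by auto
    have "head h = head a" using hb u by (simp add: follows_def)
    then have arc_h: "arc h" using no_undirectable[OF h(2)] h by (auto simp: arc_def)
    have "follows B a b"
    proof (rule ccontr)
      assume "\<not> follows B a b"
      then have opposite: "half_sign B (edge a) (head a) = - half_sign B (edge h) (head a)"
        using hb u \<open>head h = head a\<close> edge_sign_neq_iff
        unfolding follows_def by (metis minus_edge_sign(1))
      then have "a \<noteq> h" by auto
      then have ah: "edge a \<noteq> edge h" using arc_same_edge[OF a h(1)] by auto
      have fl: "follows B a (reverse h)" "follows B h (reverse a)"
        using opposite \<open>head h = head a\<close> by (auto simp: follows_def)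
      obtain Q where Q: "rooted_trail Q" "last Q = a" using a reachable_root_trail arc_def by blast
      \<comment> \<open>A trail to \<open>a\<close> either avoids \<open>h\<close> and extends by
        \<open>reverse h\<close>, or passes \<open>h\<close> before \<open>a\<close>, and then its
        part up to \<open>h\<close> extends by \<open>reverse a\<close>.\<close>
      show False
      proof (cases "edge h \<in> edges_of Q")
        case False
        then have "rooted_trail (Q @ [reverse h])"
          using Q fl h False rooted_trail_snoc[of Q "reverse h"] by simp
        from rooted_trail_last_reachable[OF this] show False
          using arc_reverse_not_reachable[OF arc_h] by simp
      next
        case True
        then obtain c where c: "c \<in> set Q" "edge c = edge h" by auto
        then have "c = h" using rooted_trail_reachable[OF Q(1)] arc_same_edge[OF arc_h] by metis
        then obtain v w where split: "Q = v @ h # w" using c by (meson split_list)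
        then have "w \<noteq> []" using Q(2) \<open>a \<noteq> h\<close> by auto
        then have "a \<in> set w" using Q(2) split by (auto simp: last_in_set)
        then have "edge a \<notin> edges_of (v @ [h])"
          using Q(1) split by (auto simp: rooted_trail_def trail_list_def image_iff)
        moreover have "rooted_trail (v @ [h])"
          using Q(1) split rooted_trail_prefix[of "v @ [h]" w] by simp
        ultimately have "rooted_trail ((v @ [h]) @ [reverse a])"
          using fl OE rooted_trail_snoc[of "v @ [h]" "reverse a"] by simp
        from rooted_trail_last_reachable[OF this] show False
          using arc_reverse_not_reachable[OF a] by simp
      qed
    qed
    then have "trail_list B (a # [] @ [b])" using OE ab by (simp add: trail_list_Cons)
    then show ?thesis unfolding arc_step_def by (intro exI[of _ "[]"]) auto
  qed
qed

text \<open>An undirectable edge starting in \<open>arc_verts a\<close> lies in the blossom of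
  \<open>a\<close>, by uniqueness of the entrance. Then its head would lie in
  \<open>arc_verts a\<close> too.\<close>

lemma boundary_arc:
  assumes a: "arc a" and g: "reachable g" and "tail g \<in> arc_verts a" "head g \<notin> arc_verts a"
  shows "arc g"
proof -
  have "\<not> undirectable (edge g)"
  proof
    assume U: "undirectable (edge g)"
    have OE: "g \<in> OE" using g by (rule reachable_oriented)
    obtain h where h: "arc h" "edge g \<in> blossom h" using undirectable_in_blossom[OF g U] by blast
    note ends = blossom_verts_ends[OF OE h(2)]
    have "edge g \<in> blossom a"
    proof (cases "tail g \<in> blossom_verts a")
      case True
      have "reverse g \<noteq> a" using U a by (auto simp: arc_def)
      then show ?thesis
        using unique_blossom_entrance[OF a, of "reverse g"] True U undirectable_iff[OF OE] by auto
    next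
      case False
      then have "head a \<in> blossom_verts h" using assms(3) ends by (auto simp: arc_verts_def)
      then have "a = h"
        using unique_blossom_entrance[OF h(1)] a arc_not_in_blossom[OF h(1) a] arc_def by blast
      then show ?thesis using h by simp
    qed
    then show False using blossom_verts_ends[OF OE] assms(4) by (auto simp: arc_verts_def)
  qed
  then show ?thesis using g by (simp add: arc_def)
qed

text \<open>The detours of consecutive steps are concatenated, and a last piece in the final blossom
  leads to \<open>x\<close>. No edge repeats, because distinct arcs have disjoint blossoms. The
  bound on the edges used turns disjoint paths into edge-disjoint trails.\<close>

lemma arc_path_trail:
  assumes "p \<noteq> []" "successively arc_step p" "distinct p" "\<And>a. a \<in> set p \<Longrightarrow> arc a"
    and "x \<in> arc_verts (last p)"
  shows "\<exists>q. q \<noteq> [] \<and> trail_list B q \<and> hd q = hd p \<and> head (last q) = x \<and>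
    edges_of q \<subseteq> (\<Union>a\<in>set p. insert (edge a) (blossom a))"
  using assms
proof (induction p rule: list_nonempty_induct)
  case (single a)
  have a: "arc a" using single by simp
  then have OE: "a \<in> OE" using reachable_oriented arc_def by auto
  show ?case
  proof (cases "x = head a")
    case True
    then show ?thesis using OE by (intro exI[of _ "[a]"]) (auto simp: trail_list_Cons)
  next
    case False
    then obtain e where e: "e \<in> blossom a" "x \<in> ends B e"
      using single by (auto simp: arc_verts_def blossom_verts_def)
    then obtain b where b: "b \<in> OE" "edge b = e" "head b = x"
      using obtain_orientation[of e x] blossom_edges by blast
    then obtain T where "trail_list B (a # T @ [b])" "edges_of T \<subseteq> blossom a"
      using blossom_trail e by metis
    then show ?thesis using b e by (intro exI[of _ "a # T @ [b]"]) auto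
  qed
next
  case (cons a p)
  then obtain q where q: "q \<noteq> []" "trail_list B q" "hd q = hd p" "head (last q) = x"
    "edges_of q \<subseteq> (\<Union>a\<in>set p. insert (edge a) (blossom a))"
    by (auto simp: successively_Cons)
  have "arc_step a (hd p)" using cons by (simp add: successively_Cons)
  then obtain T where T: "edges_of T \<subseteq> blossom a" "trail_list B (a # T @ [hd p])"
    by (auto simp: arc_step_def)
  obtain q' where q': "q = hd p # q'" using q by (cases q) auto
  have "insert (edge a) (blossom a) \<inter> insert (edge b) (blossom b) = {}" if "b \<in> set p" for b
    using that cons.prems by (intro arc_blossom_disjoint) auto
  then have "insert (edge a) (blossom a) \<inter> edges_of q = {}" using q(5) by blast
  then have "edges_of (a # T) \<inter> edges_of q' = {}" using T(1) q' by auto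
  then have "trail_list B ((a # T) @ q)"
    using trail_list_glue[of B "a # T" "hd p" q'] T(2) q(2) q' by simp
  then show ?case using q T(1) by (intro exI[of _ "(a # T) @ q"]) auto
qed

lemma finite_oriented_edges: "finite OE"
proof -
  have "OE \<subseteq> (\<lambda>(u, e, v). Oriented u e v) ` (verts B \<times> edges B \<times> verts B)"
  proof
    fix a assume a: "a \<in> OE"
    then have "tail a \<in> verts B" "edge a \<in> edges B" "head a \<in> verts B"
      using oriented_edge_ends[OF a] ends_verts[of "edge a"] by auto
    then show "a \<in> (\<lambda>(u, e, v). Oriented u e v) ` (verts B \<times> edges B \<times> verts B)"
      by (intro image_eqI[of _ _ "(tail a, edge a, head a)"]) auto
  qed
  then show ?thesis using finite_verts finite_edges by (meson finite_SigmaI finite_imageI finite_subset)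
qed

definition arc_graph :: "(('v, 'e) oriented_edge \<times> ('v, 'e) oriented_edge) set" where
  "arc_graph = {(a, b). arc a \<and> arc b \<and> arc_step a b}"

definition source_arcs :: "('v, 'e) oriented_edge set" where
  "source_arcs = {a. arc a \<and> tail a = r}"

definition target_arcs :: "'v \<Rightarrow> ('v, 'e) oriented_edge set" where
  "target_arcs x = {a. arc a \<and> x \<in> arc_verts a}"

lemma arc_oriented: "arc a \<Longrightarrow> a \<in> OE"
  by (simp add: arc_def reachable_oriented)

lemma finite_arc_sets: "finite arc_graph" "finite source_arcs" "finite (target_arcs x)"
proof -
  have "arc_graph \<subseteq> OE \<times> OE" "source_arcs \<subseteq> OE" "target_arcs x \<subseteq> OE"
    using arc_oriented by (auto simp: arc_graph_def source_arcs_def target_arcs_def)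
  then show "finite arc_graph" "finite source_arcs" "finite (target_arcs x)"
    using finite_oriented_edges by (meson finite_SigmaI finite_subset)+
qed

lemma arc_graph_path:
  assumes "path_between arc_graph source_arcs (target_arcs x) p"
  shows "p \<noteq> []" "successively arc_step p" "\<And>a. a \<in> set p \<Longrightarrow> arc a"
    "x \<in> arc_verts (last p)" "tail (hd p) = r"
proof -
  have p: "p \<noteq> []" "hd p \<in> source_arcs" "last p \<in> target_arcs x"
    "successively (\<lambda>a b. (a, b) \<in> arc_graph) p"
    using assms by (auto simp: path_between_def)
  then show "p \<noteq> []" "x \<in> arc_verts (last p)" "tail (hd p) = r"
    by (auto simp: source_arcs_def target_arcs_def)
  show "successively arc_step p"
    using p(4) by (rule successively_mono) (simp add: arc_graph_def)
  have "\<forall>a\<in>set q. arc a"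
    if "q \<noteq> []" "arc (hd q)" "successively (\<lambda>a b. (a, b) \<in> arc_graph) q" for q
    using that
  proof (induction q rule: list_nonempty_induct)
    case (cons a q)
    then have "(a, hd q) \<in> arc_graph" by (simp add: successively_Cons)
    then have "arc (hd q)" by (simp add: arc_graph_def)
    then show ?case using cons by (simp add: successively_Cons)
  qed simp
  moreover have "arc (hd p)" using p(2) by (simp add: source_arcs_def)
  ultimately show "arc a" if "a \<in> set p" for a using p(1,4) that by blast
qed

section \<open>The two inequalities between trail packings and boundaries\<close>

lemma trail_connectivity_le_boundary:
  assumes X: "x \<in> X" "X \<subseteq> verts B - {r}"
    and T: "T \<subseteq> {p. is_trail B r p x}" "pairwise edge_disjoint T"
  shows "card T \<le> card (trail_boundary B r X)"
proof -
  \<comment> \<open>The edge by which a trail first enters \<open>X\<close> belongs to the boundary;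
    edge-disjoint trails thus yield distinct boundary edges.\<close>
  have "\<exists>e. e \<in> trail_boundary B r X \<and> e \<in> edges_of p" if "p \<in> T" for p
  proof -
    have tr: "is_trail B r p x" using T that by auto
    then have "p \<noteq> []" using X by (auto simp: is_trail_def)
    then have p: "rooted_trail p" "head (last p) = x"
      using tr is_trail_iff[of p] by (auto simp: rooted_trail_def)
    then obtain u c w where split: "p = u @ c # w" "head c \<in> X" "\<forall>b\<in>set u. head b \<notin> X"
      using split_list_first_prop[of p "\<lambda>b. head b \<in> X"] X \<open>p \<noteq> []\<close> last_in_set by blast
    have "tail c \<notin> X"
    proof (cases "u = []")
      case True
      then show ?thesis using p X split by (auto simp: rooted_trail_def)
    next
      case False
      then have "follows B (last u) c" using p split by (simp add: rooted_trail_def trail_list_append)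
      then show ?thesis using split False by (simp add: follows_def)
    qed
    moreover have "reachable c" using rooted_trail_reachable[OF p(1)] split by simp
    moreover from this have "c \<in> OE" by (rule reachable_oriented)
    ultimately have "edge c \<in> trail_boundary B r X"
      using split oriented_edge_ends(1) by (auto simp: trail_boundary_def)
    then show ?thesis using split by auto
  qed
  then obtain \<phi> where \<phi>: "\<And>p. p \<in> T \<Longrightarrow> \<phi> p \<in> trail_boundary B r X \<and> \<phi> p \<in> edges_of p" by metis
  have "inj_on \<phi> T"
  proof (rule inj_onI, rule ccontr)
    fix p q assume "p \<in> T" "q \<in> T" "\<phi> p = \<phi> q" "p \<noteq> q"
    then have "\<phi> p \<in> edges_of p \<inter> edges_of q" using \<phi> by (metis IntI)
    moreover have "edges_of p \<inter> edges_of q = {}"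
      using T(2) \<open>p \<in> T\<close> \<open>q \<in> T\<close> \<open>p \<noteq> q\<close> by (simp add: pairwise_def edge_disjoint_def)
    ultimately show False by simp
  qed
  moreover have "finite (trail_boundary B r X)" using finite_edges by (simp add: trail_boundary_def)
  ultimately show ?thesis using \<phi> by (intro card_inj_on_le) auto
qed

lemma boundary_le_separator:
  assumes x: "x \<in> verts B - {r}" and Z: "finite Z" "separates arc_graph source_arcs (target_arcs x) Z"
  shows "\<exists>X. x \<in> X \<and> X \<subseteq> verts B - {r} \<and> card (trail_boundary B r X) \<le> card Z"
proof -
  \<comment> \<open>\<open>R\<close> consists of the arcs that can be reached from the sources past
    \<open>Z\<close>; the target \<open>UNIV\<close> leaves the end of the path free.\<close>
  define R where
    "R = {last p | p. path_between arc_graph source_arcs UNIV p \<and> (\<forall>a\<in>set p. arc a) \<and> set p \<inter> Z = {}}"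
  have R_arc: "arc a" if "a \<in> R" for a
    using that by (auto simp: R_def path_between_def)
  have R_source: "g \<in> R" if "arc g" "tail g = r" "g \<notin> Z" for g
    unfolding R_def using that by (intro CollectI exI[of _ "[g]"]) (auto simp: path_between_def source_arcs_def)
  have R_step: "g \<in> R" if a: "a \<in> R" and g: "arc g" "arc_step a g" "g \<notin> Z" for a g
  proof -
    from a obtain p where "path_between arc_graph source_arcs UNIV p" "\<forall>a\<in>set p. arc a"
      "set p \<inter> Z = {}" "last p = a" by (auto simp: R_def)
    then show ?thesis
      unfolding R_def using g R_arc[OF a]
      by (intro CollectI exI[of _ "p @ [g]"])
        (auto simp: path_between_def successively_append_iff arc_graph_def)
  qed
  define X where "X = verts B - {r} - (\<Union>a\<in>R. arc_verts a)"
  have "x \<notin> arc_verts a" if "a \<in> R" for a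
  proof
    assume "x \<in> arc_verts a"
    then have "a \<in> target_arcs x" using R_arc \<open>a \<in> R\<close> by (simp add: target_arcs_def)
    moreover obtain p where "path_between arc_graph source_arcs UNIV p" "set p \<inter> Z = {}" "last p = a"
      using \<open>a \<in> R\<close> by (auto simp: R_def)
    ultimately have "path_between arc_graph source_arcs (target_arcs x) p" "set p \<inter> Z = {}"
      by (auto simp: path_between_def)
    then show False using Z by (auto simp: separates_def)
  qed
  then have "x \<in> X" using x by (simp add: X_def)
  moreover have "X \<subseteq> verts B - {r}" by (auto simp: X_def)
  moreover have "trail_boundary B r X \<subseteq> edge ` Z"
  proof
    fix e assume "e \<in> trail_boundary B r X"
    then obtain g where g: "g \<in> OE" "edge g = e" "head g \<in> X" "tail g \<notin> X" "reachable g"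
      by (auto simp: trail_boundary_def)
    \<comment> \<open>If \<open>g\<close> were not in \<open>Z\<close>, it would itself belong to
      \<open>R\<close>, and its head would be covered by \<open>arc_verts g\<close> instead of lying
      in \<open>X\<close>.\<close>
    have "g \<in> Z"
    proof (rule ccontr)
      assume "g \<notin> Z"
      have "g \<in> R"
      proof (cases "tail g = r")
        case True
        then have "arc g" using g not_undirectable_root by (auto simp: arc_def)
        then show ?thesis using R_source True \<open>g \<notin> Z\<close> by blast
      next
        case False
        then obtain a where a: "a \<in> R" "tail g \<in> arc_verts a"
          using g oriented_edge_ends[OF g(1)] ends_verts[of "edge g"] by (auto simp: X_def)
        have hd: "head g \<notin> arc_verts a" using g a by (auto simp: X_def)
        have "arc g" using boundary_arc[OF R_arc[OF a(1)] g(5) a(2) hd] .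
        moreover have "a \<noteq> g" using hd by (auto simp: arc_verts_def)
        ultimately show ?thesis
          using R_step[OF a(1)] arc_step_intro[OF R_arc[OF a(1)]] a(2) \<open>g \<notin> Z\<close> by blast
      qed
      then show False using g by (auto simp: X_def arc_verts_def)
    qed
    then show "e \<in> edge ` Z" using g by blast
  qed
  then have "card (trail_boundary B r X) \<le> card Z" using Z(1) by (rule surj_card_le[rotated])
  ultimately show ?thesis by blast
qed

text \<open>Menger's theorem gives vertex-disjoint paths of arcs. Each becomes a trail inside the
  arcs and blossoms of its path, and these edge sets are disjoint for different paths.\<close>

lemma disjoint_trails_exist:
  assumes k: "\<And>Z. finite Z \<Longrightarrow> separates arc_graph source_arcs (target_arcs x) Z \<Longrightarrow> k \<le> card Z"
  shows "\<exists>T. T \<subseteq> {p. is_trail B r p x} \<and> pairwise edge_disjoint T \<and> card T = k"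
proof -
  obtain P where P: "disjoint_paths arc_graph source_arcs (target_arcs x) P" "card P = k"
    using vertex_menger[OF finite_arc_sets k] by blast
  let ?D = "\<lambda>p. \<Union>a\<in>set p. insert (edge a) (blossom a)"
  have path: "path_between arc_graph source_arcs (target_arcs x) p" "distinct p" if "p \<in> P" for p
    using P that by (auto simp: disjoint_paths_def)
  have "\<exists>q. q \<noteq> [] \<and> is_trail B r q x \<and> edges_of q \<subseteq> ?D p" if "p \<in> P" for p
  proof -
    note p = arc_graph_path[OF path(1)[OF that]] and distinct = path(2)[OF that]
    obtain q where "q \<noteq> []" "trail_list B q" "hd q = hd p" "head (last q) = x" "edges_of q \<subseteq> ?D p"
      using arc_path_trail[OF p(1,2) distinct p(3,4)] by blast
    then show ?thesis using p(5) root_vert by (intro exI[of _ q]) (simp add: is_trail_iff)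
  qed
  then obtain q where q: "\<And>p. p \<in> P \<Longrightarrow> q p \<noteq> [] \<and> is_trail B r (q p) x \<and> edges_of (q p) \<subseteq> ?D p"
    by metis
  have disj: "edges_of (q p) \<inter> edges_of (q p') = {}" if pp: "p \<in> P" "p' \<in> P" "p \<noteq> p'" for p p'
  proof -
    have sets: "set p \<inter> set p' = {}" using P(1) pp by (simp add: disjoint_paths_def pairwise_def)
    have arcs_disjoint: "insert (edge a) (blossom a) \<inter> insert (edge b) (blossom b) = {}"
      if "a \<in> set p" "b \<in> set p'" for a b
      using that sets arc_graph_path(3)[OF path(1)[OF pp(1)]] arc_graph_path(3)[OF path(1)[OF pp(2)]]
      by (intro arc_blossom_disjoint) auto
    have "?D p \<inter> ?D p' = {}"
    proof (rule equals0I)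
      fix e assume "e \<in> ?D p \<inter> ?D p'"
      then obtain a b where ab: "a \<in> set p" "b \<in> set p'"
        "e \<in> insert (edge a) (blossom a) \<inter> insert (edge b) (blossom b)" by blast
      then show False by (simp only: arcs_disjoint[OF ab(1,2)] empty_iff)
    qed
    moreover have "edges_of (q p) \<subseteq> ?D p" "edges_of (q p') \<subseteq> ?D p'" using q pp by simp_all
    ultimately show ?thesis by (meson disjoint_iff subsetD)
  qed
  have "inj_on q P"
  proof (rule inj_onI, rule ccontr)
    fix p p' assume pp: "p \<in> P" "p' \<in> P" "q p = q p'" "p \<noteq> p'"
    then show False using disj[OF pp(1,2,4)] q[OF pp(1)] by auto
  qed
  then have "card (q ` P) = k" using P(2) by (simp add: card_image)
  moreover have "pairwise edge_disjoint (q ` P)"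
    using disj by (auto simp: pairwise_def edge_disjoint_def)
  ultimately show ?thesis using q by (intro exI[of _ "q ` P"]) auto
qed

end

theorem theorem4p2:
  fixes B :: "('v, 'e) bigraph" and r x :: 'v
  assumes "finite_rooted_bidirected_graph B r"
    and "edge_clean B r"
    and "x \<in> verts B - {r}"
  shows "trail_connectivity B r x =
    Min {card (trail_boundary B r X) | X. x \<in> X \<and> X \<subseteq> verts B - {r}}"
proof -
  interpret edge_clean_bidirected_graph B r
    using assms(1,2) by (intro edge_clean_bidirected_graph.intro edge_clean_bidirected_graph_axioms.intro)
  define cuts where "cuts = {card (trail_boundary B r X) | X. x \<in> X \<and> X \<subseteq> verts B - {r}}"
  define packings where
    "packings = {card T | T. T \<subseteq> {p. is_trail B r p x} \<and> pairwise edge_disjoint T}"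
  have "cuts \<subseteq> (\<lambda>X. card (trail_boundary B r X)) ` Pow (verts B)"
    unfolding cuts_def by auto
  then have finite_cuts: "finite cuts"
    using finite_verts by (meson finite_Pow_iff finite_imageI finite_subset)
  have nonempty: "cuts \<noteq> {}" using assms(3) by (auto simp: cuts_def)
  have weak: "m \<le> Min cuts" if "m \<in> packings" for m
  proof (rule Min.boundedI[OF finite_cuts nonempty])
    fix c assume "c \<in> cuts"
    then show "m \<le> c"
      using that trail_connectivity_le_boundary by (auto simp: cuts_def packings_def)
  qed
  have le_separator: "Min cuts \<le> card Z"
    if Z: "finite Z" "separates arc_graph source_arcs (target_arcs x) Z" for Z
  proof -
    obtain X where X: "x \<in> X" "X \<subseteq> verts B - {r}" "card (trail_boundary B r X) \<le> card Z"
      using boundary_le_separator[OF assms(3) Z] by blast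
    then have "card (trail_boundary B r X) \<in> cuts" by (auto simp: cuts_def)
    then have "Min cuts \<le> card (trail_boundary B r X)" using finite_cuts by (rule Min_le[rotated])
    then show ?thesis using X(3) by simp
  qed
  \<comment> \<open>Every separator has at least \<open>Min cuts\<close> elements, so this number is
    a valid size for Menger's theorem.\<close>
  obtain T where "T \<subseteq> {p. is_trail B r p x}" "pairwise edge_disjoint T" "card T = Min cuts"
    using disjoint_trails_exist[of x "Min cuts", OF le_separator] by blast
  then have "Min cuts \<in> packings"
    unfolding packings_def by (intro CollectI exI[of _ T] conjI) (rule sym)
  moreover have "finite packings"
    unfolding finite_nat_set_iff_bounded_le using weak by blast
  ultimately have "Max packings = Min cuts" using weak by (intro Max_eqI)
  then show ?thesis by (simp only: trail_connectivity_def packings_def cuts_def)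
qed

end
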